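(* Let $N\ge2$ be an integer, $\mu>0$, $K\ge 1$, and let $\kappa\in\{\sqrt{1-1/K^2},-\sqrt{1-1/K^2}\}$. Let $P(\lambda,\tau)$ be either of the two functions $$P_{\mathrm{Fix}}(\lambda,\tau)=\lambda^2+\mu\lambda+K\mu(1-\kappa)-K\mu(1+\kappa)e^{-\lambda\tau},$$ $$P_U(\lambda,\tau)=\lambda^2+\mu\lambda+K\mu(1-\kappa)+\frac{K\mu}{N-1}(1+\kappa)e^{-\lambda\tau},$$ and set $b=\mu^2-2K\mu(1-\kappa)$ and, respectively, $$c=-4K^2\mu^2\kappa\ \text{ for } P_{\mathrm{Fix}},\qquad c=(K\mu)^2(1-\kappa)^2-\Bigl(\frac{K\mu}{N-1}\Bigr)^2(1+\kappa)^2\ \text{ for } P_U .$$ Let $\omega_\pm^2=-\tfrac12 b\pm\tfrac12\sqrt{b^2-4c}$ (a necessary condition for $\omega_\pm$ to be real is $b^2-4c\ge 0$). Whenever $\omega_\pm$ is a positive real number and $\lambda=\mathrm{i}\omega_\pm$ is a root of $P(\cdot,\tau^* )$ for some $\tau^*\ge 0$, the sign of the crossing speed $\delta(\omega_\pm)$ is that of $AC+BD=\omega_\pm^2(2\omega_\pm^2+b)=\pm\omega_\pm^2\sqrt{b^2-4c}$, and $$\mathrm{sgn}(\delta(\omega_+))=+1,\qquad \mathrm{sgn}(\delta(\omega_-))=-1 .$$ That is, whenever $\mathrm{i}\omega_+$ with $\omega_+>0$ is a root, it crosses the imaginary axis from left to right as $\tau$ increases through $\tau^*$, and whenever $\mathrm{i}\omega_-$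 with $\omega_->0$ is a root, it crosses the imaginary axis from right to left as $\tau$ increases through $\tau^*$.
   Context: For a root $\lambda=\mathrm{i}\omega$ of $P(\cdot,\tau^* )$, the crossing speed is $$\delta(\omega):=\mathrm{Re}\left(\frac{d\lambda}{d\tau}\right)=\mathrm{Re}\left(-\frac{\partial P}{\partial\tau}\Bigl(\frac{\partial P}{\partial\lambda}\Bigr)^{-1}\right)$$ evaluated at $(\lambda,\tau)=(\mathrm{i}\omega,\tau^* )$, where $\lambda(\tau)$ denotes the branch of roots of $P(\cdot,\tau)$ through $\mathrm{i}\omega$ at $\tau=\tau^*$. It is written as $\delta(\omega)=\dfrac{AC+BD}{C^2+D^2}$, where for both functions, at $\omega=\omega_\pm$ and $\tau=\tau^*$, $$A=\mu\omega^2,\quad B=\omega^3-K\mu\omega(1-\kappa),\quad C=\mu-\tau\omega^2+\tau K\mu(1-\kappa),\quad D=\omega(2+\mu\tau).$$ The functions $P_{\mathrm{Fix}}$ and $P_U$ are the characteristic functions (in normalized parameters, with local frequency scaled to $1$) of a fully connected $N$-node delay network of second-order phase-locked loops at a synchronized equilibrium $\phi^*=\phi^\pm$, where $\kappa=\cos(2\phi^* )$; the first governs symmetry-preserving and the second symmetry-breaking bifurcations.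
   Formalization: The final sign and crossing claims are stated only for b²−4c ≠ 0: if b² = 4c then ω₊ = ω₋ and δ = 0, so they fail (e.g. P_Fix with −1<κ<0 and μ = 2K(1−√(−κ))²); all other claims are stated without this restriction. *)

theory Defs
  imports "HOL-Analysis.Analysis"
begin

definition P_Fix :: "real \<Rightarrow> real \<Rightarrow> real \<Rightarrow> complex \<Rightarrow> real \<Rightarrow> complex" where
  "P_Fix K \<mu> \<kappa> z \<tau> =
     z\<^sup>2 + of_real \<mu> * z + of_real (K * \<mu> * (1 - \<kappa>))
       - of_real (K * \<mu> * (1 + \<kappa>)) * exp (- z * of_real \<tau>)"

definition P_U :: "nat \<Rightarrow> real \<Rightarrow> real \<Rightarrow> real \<Rightarrow> complex \<Rightarrow> real \<Rightarrow> complex" where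
  "P_U N K \<mu> \<kappa> z \<tau> =
     z\<^sup>2 + of_real \<mu> * z + of_real (K * \<mu> * (1 - \<kappa>))
       + of_real (K * \<mu> / (real N - 1) * (1 + \<kappa>)) * exp (- z * of_real \<tau>)"

definition c_Fix :: "real \<Rightarrow> real \<Rightarrow> real \<Rightarrow> real" where
  "c_Fix K \<mu> \<kappa> = - 4 * K\<^sup>2 * \<mu>\<^sup>2 * \<kappa>"

definition c_U :: "nat \<Rightarrow> real \<Rightarrow> real \<Rightarrow> real \<Rightarrow> real" where
  "c_U N K \<mu> \<kappa> = (K * \<mu>)\<^sup>2 * (1 - \<kappa>)\<^sup>2 - (K * \<mu> / (real N - 1))\<^sup>2 * (1 + \<kappa>)\<^sup>2"

definition b_coeff :: "real \<Rightarrow> real \<Rightarrow> real \<Rightarrow> real" where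
  "b_coeff K \<mu> \<kappa> = \<mu>\<^sup>2 - 2 * K * \<mu> * (1 - \<kappa>)"

(* The sign s is 1 for omega_+ and -1 for omega_-.  The square root is the complex one, so that
   a negative discriminant really gives a non-real value (the library's real sqrt is odd). *)
definition omega_sq :: "real \<Rightarrow> real \<Rightarrow> real \<Rightarrow> complex" where
  "omega_sq s b c = - of_real b / 2 + of_real s * csqrt (of_real (b\<^sup>2 - 4 * c)) / 2"

definition crossing_speed :: "(complex \<Rightarrow> real \<Rightarrow> complex) \<Rightarrow> real \<Rightarrow> real \<Rightarrow> real" where
  "crossing_speed P \<omega> \<tau>0 =
     Re (- vector_derivative (\<lambda>\<tau>. P (\<i> * of_real \<omega>) \<tau>) (at \<tau>0)
           * inverse (deriv (\<lambda>z. P z \<tau>0) (\<i> * of_real \<omega>)))"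

definition coeff_A :: "real \<Rightarrow> real \<Rightarrow> real" where
  "coeff_A \<mu> \<omega> = \<mu> * \<omega>\<^sup>2"

definition coeff_B :: "real \<Rightarrow> real \<Rightarrow> real \<Rightarrow> real \<Rightarrow> real" where
  "coeff_B K \<mu> \<kappa> \<omega> = \<omega>^3 - K * \<mu> * \<omega> * (1 - \<kappa>)"

definition coeff_C :: "real \<Rightarrow> real \<Rightarrow> real \<Rightarrow> real \<Rightarrow> real \<Rightarrow> real" where
  "coeff_C K \<mu> \<kappa> \<omega> \<tau> = \<mu> - \<tau> * \<omega>\<^sup>2 + \<tau> * K * \<mu> * (1 - \<kappa>)"

definition coeff_D :: "real \<Rightarrow> real \<Rightarrow> real \<Rightarrow> real" where
  "coeff_D \<mu> \<omega> \<tau> = \<omega> * (2 + \<mu> * \<tau>)"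

(* l is the branch of roots of P(., tau) through z0 at tau = tau0: near (z0, tau0) the zero set
   of P is exactly the graph of the continuous function l, which determines l near tau0. *)
definition root_branch ::
  "(complex \<Rightarrow> real \<Rightarrow> complex) \<Rightarrow> complex \<Rightarrow> real \<Rightarrow> (real \<Rightarrow> complex) \<Rightarrow> bool" where
  "root_branch P z0 \<tau>0 l \<longleftrightarrow>
     l \<tau>0 = z0 \<and>
     (\<exists>\<epsilon>>0. \<exists>r>0. continuous_on (ball \<tau>0 \<epsilon>) l \<and>
        (\<forall>\<tau>\<in>ball \<tau>0 \<epsilon>. {z \<in> ball z0 r. P z \<tau> = 0} = {l \<tau>}))"

definition crosses_left_to_right :: "(complex \<Rightarrow> real \<Rightarrow> complex) \<Rightarrow> complex \<Rightarrow> real \<Rightarrow> bool" where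
  "crosses_left_to_right P z0 \<tau>0 \<longleftrightarrow>
     (\<exists>l. root_branch P z0 \<tau>0 l \<and> Re z0 = 0 \<and>
        (\<forall>\<^sub>F \<tau> in at_left \<tau>0. Re (l \<tau>) < 0) \<and>
        (\<forall>\<^sub>F \<tau> in at_right \<tau>0. Re (l \<tau>) > 0))"

definition crosses_right_to_left :: "(complex \<Rightarrow> real \<Rightarrow> complex) \<Rightarrow> complex \<Rightarrow> real \<Rightarrow> bool" where
  "crosses_right_to_left P z0 \<tau>0 \<longleftrightarrow>
     (\<exists>l. root_branch P z0 \<tau>0 l \<and> Re z0 = 0 \<and>
        (\<forall>\<^sub>F \<tau> in at_left \<tau>0. Re (l \<tau>) > 0) \<and>
        (\<forall>\<^sub>F \<tau> in at_right \<tau>0. Re (l \<tau>) < 0))"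

end

(* The root branch comes from the inverse function theorem applied to (z, t) |-> (P z t, t).
   At a root z = i w the exponential term equals -(z^2 + mu z + alpha), so the partial derivatives
   of P do not involve it: -dP/dt = A + i B and dP/dz = C + i D, where D > 0 keeps the root simple.
   In A C + B D the delay cancels, leaving w^2 (2 w^2 + b), and 2 w^2 + b is plus or minus the
   root of the discriminant by the definition of w. *)
theory Submission imports Defs begin

text \<open>An implicit function theorem. The derivative of
  \<open>(z, t) \<mapsto> (P z t, t)\<close> is block triangular, hence invertible once
  \<open>Pz\<close> is nonzero at the base point. The slice of the local inverse over first
  coordinate 0 parametrizes the zero set of \<open>P\<close>, and differentiating that slice gives
  the velocity of the branch.\<close>

lemma root_branch_exists:
  fixes P :: "complex \<Rightarrow> real \<Rightarrow> complex" and Pz Pt :: "complex \<times> real \<Rightarrow> complex"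
  assumes "open U" and U0: "(z0, t0) \<in> U"
    and der: "\<And>p. p \<in> U \<Longrightarrow>
      ((\<lambda>q. P (fst q) (snd q)) has_derivative (\<lambda>h. Pz p * fst h + snd h *\<^sub>R Pt p)) (at p)"
    and cont: "continuous_on U Pz" "continuous_on U Pt"
    and zero: "P z0 t0 = 0" and nz: "Pz (z0, t0) \<noteq> 0"
  obtains l where "root_branch P z0 t0 l"
    and "(l has_vector_derivative - Pt (z0, t0) / Pz (z0, t0)) (at t0)"
proof -
  define F where "F = (\<lambda>q. (P (fst q) (snd q), snd q))"
  define L where "L = (\<lambda>p (h :: complex \<times> real). (Pz p * fst h + snd h *\<^sub>R Pt p, snd h))"
  \<comment> \<open>\<open>M\<close> inverts \<open>L (z0, t0)\<close>: it solves
    \<open>Pz * x + h *\<^sub>R Pt = y\<close> for \<open>x\<close> and keeps the second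
    component.\<close>
  define M where
    "M = (\<lambda>h :: complex \<times> real. ((fst h - snd h *\<^sub>R Pt (z0, t0)) / Pz (z0, t0), snd h))"
  have blL: "bounded_linear (L p)" for p
    unfolding L_def by (intro bounded_linear_intros)
  have blM: "bounded_linear M"
    unfolding M_def divide_inverse by (intro bounded_linear_intros)
  have F': "(F has_derivative blinfun_apply (Blinfun (L p))) (at p)" if "p \<in> U" for p
    unfolding bounded_linear_Blinfun_apply[OF blL] unfolding F_def L_def
    by (intro has_derivative_Pair der that has_derivative_snd has_derivative_ident)
  have contL: "continuous_on U (\<lambda>p. Blinfun (L p))"
    by (rule continuous_on_blinfun_componentwise)
      (unfold bounded_linear_Blinfun_apply[OF blL], unfold L_def,
        auto intro!: continuous_intros cont)
  have inv: "Blinfun M o\<^sub>L Blinfun (L (z0, t0)) = id_blinfun"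
    by (rule blinfun_eqI)
      (simp add: bounded_linear_Blinfun_apply[OF blL] bounded_linear_Blinfun_apply[OF blM],
        simp add: L_def M_def nz)
  obtain U' V g g' where U': "open U'" "U' \<subseteq> U" "(z0, t0) \<in> U'"
    and V: "open V" "F (z0, t0) \<in> V" and hom: "homeomorphism U' V F g"
    and g': "\<And>y. y \<in> V \<Longrightarrow> (g has_derivative (g' y)) (at y)"
      "\<And>y. y \<in> V \<Longrightarrow> g' y = inv (blinfun_apply (Blinfun (L (g y))))"
      "\<And>y. y \<in> V \<Longrightarrow> bij (blinfun_apply (Blinfun (L (g y))))"
    using inverse_function_theorem[OF \<open>open U\<close> F' contL U0 inv] by blast
  have F0: "F (z0, t0) = (0, t0)" by (simp add: F_def zero)
  then have V0: "(0, t0) \<in> V" using V by simp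
  have g0: "g (0, t0) = (z0, t0)"
    using hom U' F0 by (metis homeomorphism_apply1)
  define l where "l = (\<lambda>t. fst (g (0, t)))"
  have l0: "l t0 = z0" by (simp add: l_def g0)
  \<comment> \<open>\<open>root_branch\<close> asks for one radius \<open>r\<close> that serves all
    nearby delays, so \<open>U'\<close> is shrunk to a product. Further down \<open>e\<close> is
    chosen so small that \<open>l\<close> stays inside \<open>ball z0 r\<close>.\<close>
  obtain A B where AB: "open A" "open B" "(z0, t0) \<in> A \<times> B" "A \<times> B \<subseteq> U'"
    using open_prod_elim[OF U'(1,3)] by blast
  then obtain r where r: "r > 0" "ball z0 r \<subseteq> A"
    by (metis mem_Sigma_iff openE)
  define S where "S = (\<lambda>t. (0 :: complex, t :: real)) -` V"
  have S: "open S" unfolding S_def by (rule open_vimage[OF V(1)]) (intro continuous_intros)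
  have cl: "continuous_on S l"
    unfolding l_def
    by (intro continuous_on_fst continuous_on_compose2[OF homeomorphism_cont2[OF hom]])
      (auto simp: S_def intro!: continuous_intros)
  have "open (S \<inter> l -` ball z0 r)"
    by (rule continuous_open_preimage[OF cl S open_ball])
  then have "open (B \<inter> (S \<inter> l -` ball z0 r))" using AB by blast
  moreover have "t0 \<in> B \<inter> (S \<inter> l -` ball z0 r)" using AB V0 l0 r by (auto simp: S_def)
  ultimately obtain e where e: "e > 0" "ball t0 e \<subseteq> B \<inter> (S \<inter> l -` ball z0 r)"
    by (metis openE)
  have roots: "{z \<in> ball z0 r. P z t = 0} = {l t}" if t: "t \<in> ball t0 e" for t
  proof -
    have "(0, t) \<in> V" using t e by (auto simp: S_def)
    then have "F (g (0, t)) = (0, t)" using hom by (metis homeomorphism_apply2)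
    then have "P (l t) t = 0" by (auto simp: F_def l_def)
    moreover have "l t \<in> ball z0 r" using t e by blast
    \<comment> \<open>Uniqueness of the root: \<open>F (z, t) = (0, t)\<close>, and \<open>g\<close>
      undoes \<open>F\<close> on \<open>U'\<close>, so \<open>z\<close> must be the first component
      of \<open>g (0, t)\<close>.\<close>
    moreover have "z = l t" if "z \<in> ball z0 r" "P z t = 0" for z
    proof -
      have "(z, t) \<in> U'" using that t e r AB by blast
      then have "g (F (z, t)) = (z, t)" using hom by (metis homeomorphism_apply1)
      then show ?thesis using that by (simp add: F_def l_def)
    qed
    ultimately show ?thesis by blast
  qed
  have "continuous_on (ball t0 e) l"
    by (rule continuous_on_subset[OF cl]) (use e in blast)
  then have "root_branch P z0 t0 l"
    unfolding root_branch_def using l0 e(1) r(1) roots by blast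
  moreover have "(l has_vector_derivative - Pt (z0, t0) / Pz (z0, t0)) (at t0)"
  proof -
    have bij: "bij (L (z0, t0))"
      using g'(3)[OF V0] by (simp add: g0 bounded_linear_Blinfun_apply[OF blL])
    \<comment> \<open>The derivative of \<open>g\<close> is known only as an abstract
      \<open>inv\<close>. Exhibiting the preimage of \<open>(0, h)\<close> evaluates it in the one
      direction that the slice uses.\<close>
    have "L (z0, t0) (h *\<^sub>R (- Pt (z0, t0) / Pz (z0, t0)), h) = (0, h)" for h
      using nz by (simp add: L_def)
    then have "inv (L (z0, t0)) (0, h) = (h *\<^sub>R (- Pt (z0, t0) / Pz (z0, t0)), h)" for h
      using bij by (metis bij_inv_eq_iff)
    then have dg: "g' (0, t0) (0, h) = (h *\<^sub>R (- Pt (z0, t0) / Pz (z0, t0)), h)" for h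
      using g'(2)[OF V0] by (simp add: g0 bounded_linear_Blinfun_apply[OF blL])
    have "((\<lambda>t. (0, t)) has_derivative (\<lambda>h. (0, h))) (at t0)"
      by (auto intro!: derivative_eq_intros)
    from has_derivative_compose[OF this g'(1)[OF V0]] show ?thesis
      unfolding has_vector_derivative_def l_def dg by (auto dest: has_derivative_fst)
  qed
  ultimately show thesis using that by blast
qed

text \<open>A common form for both characteristic functions, which share the delay-free part and
  differ only in the coefficient of the exponential.\<close>

definition delayed_quadratic :: "real \<Rightarrow> real \<Rightarrow> real \<Rightarrow> complex \<Rightarrow> real \<Rightarrow> complex" where
  "delayed_quadratic \<mu> \<alpha> \<beta> z \<tau> =
     z\<^sup>2 + of_real \<mu> * z + of_real \<alpha> + of_real \<beta> * exp (- z * of_real \<tau>)"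

lemma P_Fix_eq_delayed_quadratic:
  "P_Fix K \<mu> \<kappa> = delayed_quadratic \<mu> (K * \<mu> * (1 - \<kappa>)) (- (K * \<mu> * (1 + \<kappa>)))"
  by (simp add: P_Fix_def delayed_quadratic_def fun_eq_iff)

lemma P_U_eq_delayed_quadratic:
  "P_U N K \<mu> \<kappa> = delayed_quadratic \<mu> (K * \<mu> * (1 - \<kappa>)) (K * \<mu> / (real N - 1) * (1 + \<kappa>))"
  by (simp add: P_U_def delayed_quadratic_def fun_eq_iff)

lemma has_derivative_delayed_quadratic:
  "((\<lambda>q. delayed_quadratic \<mu> \<alpha> \<beta> (fst q) (snd q)) has_derivative
     (\<lambda>h. (2 * fst p + of_real \<mu> - of_real \<beta> * of_real (snd p) * exp (- fst p * of_real (snd p))) * fst h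
        + snd h *\<^sub>R (- of_real \<beta> * fst p * exp (- fst p * of_real (snd p))))) (at p)"
proof -
  let ?u = "\<lambda>q :: complex \<times> real. - fst q * of_real (snd q)"
  have "(?u has_derivative (\<lambda>h. - (fst p * of_real (snd h)) - fst h * of_real (snd p))) (at p)"
    by (auto intro!: derivative_eq_intros simp: fun_eq_iff algebra_simps)
  then have "((\<lambda>q. exp (?u q)) has_derivative
      (\<lambda>h. exp (?u p) * (- (fst p * of_real (snd h)) - fst h * of_real (snd p)))) (at p)"
    by (rule has_derivative_compose) (rule DERIV_exp[unfolded has_field_derivative_def])
  then show ?thesis
    unfolding delayed_quadratic_def
    by (auto intro!: derivative_eq_intros simp: fun_eq_iff algebra_simps scaleR_conv_of_real)
qed

text \<open>The speed, defined through partial derivatives of \<open>P\<close>, is here matched with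
  the real part of the actual velocity of the branch: both come from one complex quotient. This is
  what later turns the sign of the speed into a direction of crossing.\<close>

lemma
  assumes "delayed_quadratic \<mu> \<alpha> \<beta> (\<i> * of_real \<omega>) \<tau> = 0"
  defines "A \<equiv> \<mu> * \<omega>\<^sup>2" and "B \<equiv> \<omega>^3 - \<alpha> * \<omega>"
    and "C \<equiv> \<mu> - \<tau> * \<omega>\<^sup>2 + \<tau> * \<alpha>" and "D \<equiv> \<omega> * (2 + \<mu> * \<tau>)"
  shows root_branch_delayed_quadratic: "D \<noteq> 0 \<Longrightarrow>
      \<exists>l. root_branch (delayed_quadratic \<mu> \<alpha> \<beta>) (\<i> * of_real \<omega>) \<tau> l \<and>
        (l has_vector_derivative Complex A B / Complex C D) (at \<tau>)"
    and crossing_speed_delayed_quadratic: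
      "crossing_speed (delayed_quadratic \<mu> \<alpha> \<beta>) \<omega> \<tau> = Re (Complex A B / Complex C D)"
proof -
  let ?z = "\<i> * complex_of_real \<omega>"
  define Pz where "Pz = (\<lambda>p :: complex \<times> real.
    2 * fst p + of_real \<mu> - of_real \<beta> * of_real (snd p) * exp (- fst p * of_real (snd p)))"
  define Pt where "Pt = (\<lambda>p :: complex \<times> real.
    - of_real \<beta> * fst p * exp (- fst p * of_real (snd p)))"
  have E: "of_real \<beta> * exp (- ?z * of_real \<tau>) = - (?z\<^sup>2 + of_real \<mu> * ?z + of_real \<alpha>)"
    using assms(1) unfolding delayed_quadratic_def by (metis add.inverse_unique minus_minus add.commute)
  \<comment> \<open>The exponential is grouped with its coefficient so that rewriting by
    \<open>E\<close> eliminates both at once; the same grouping is used for \<open>Pt\<close>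
    below.\<close>
  have "Pz (?z, \<tau>) = 2 * ?z + of_real \<mu> - of_real \<tau> * (of_real \<beta> * exp (- ?z * of_real \<tau>))"
    by (simp add: Pz_def)
  then have Pz: "Pz (?z, \<tau>) = Complex C D"
    unfolding E by (simp add: C_def D_def complex_eq_iff power2_eq_square algebra_simps)
  have "Pt (?z, \<tau>) = - ?z * (of_real \<beta> * exp (- ?z * of_real \<tau>))"
    by (simp add: Pt_def)
  then have Pt: "- Pt (?z, \<tau>) = Complex A B"
    unfolding E by (simp add: A_def B_def complex_eq_iff power2_eq_square power3_eq_cube algebra_simps)
  have der: "((\<lambda>q. delayed_quadratic \<mu> \<alpha> \<beta> (fst q) (snd q)) has_derivative
      (\<lambda>h. Pz p * fst h + snd h *\<^sub>R Pt p)) (at p)" for p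
    unfolding Pz_def Pt_def by (rule has_derivative_delayed_quadratic)
  have cont: "continuous_on UNIV Pz" "continuous_on UNIV Pt"
    unfolding Pz_def Pt_def by (intro continuous_intros)+
  show "\<exists>l. root_branch (delayed_quadratic \<mu> \<alpha> \<beta>) ?z \<tau> l \<and>
      (l has_vector_derivative Complex A B / Complex C D) (at \<tau>)" if "D \<noteq> 0"
  proof -
    have "Pz (?z, \<tau>) \<noteq> 0" using that by (simp add: Pz complex_eq_iff)
    then show ?thesis
      using root_branch_exists[OF open_UNIV UNIV_I der cont assms(1)] by (metis Pz Pt)
  qed
  have "((\<lambda>z. delayed_quadratic \<mu> \<alpha> \<beta> z \<tau>) has_field_derivative Pz (?z, \<tau>)) (at ?z)"
    unfolding delayed_quadratic_def Pz_def
    by (auto intro!: derivative_eq_intros simp: algebra_simps)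
  moreover have "((\<lambda>t. delayed_quadratic \<mu> \<alpha> \<beta> ?z t) has_vector_derivative Pt (?z, \<tau>)) (at \<tau>)"
  proof -
    \<comment> \<open>The partial derivative in the delay is the total derivative composed with the
      vertical line through \<open>?z\<close>.\<close>
    have "((\<lambda>t. (?z, t)) has_derivative (\<lambda>h. (0, h))) (at \<tau>)"
      by (auto intro!: derivative_eq_intros)
    from has_derivative_compose[OF this der] show ?thesis
      by (simp add: has_vector_derivative_def)
  qed
  ultimately show "crossing_speed (delayed_quadratic \<mu> \<alpha> \<beta>) \<omega> \<tau> = Re (Complex A B / Complex C D)"
    unfolding crossing_speed_def
    by (simp only: DERIV_imp_deriv vector_derivative_at Pz Pt divide_inverse)
qed

text \<open>\<open>Re (l t)\<close> vanishes at \<open>t0\<close> and has nonzero derivative there,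
  so it changes sign strictly.\<close>

lemma
  assumes "root_branch P z0 t0 l" "(l has_vector_derivative l') (at t0)" "Re z0 = 0"
  shows crosses_left_to_rightI: "Re l' > 0 \<Longrightarrow> crosses_left_to_right P z0 t0"
    and crosses_right_to_leftI: "Re l' < 0 \<Longrightarrow> crosses_right_to_left P z0 t0"
proof -
  have R: "((\<lambda>t. Re (l t)) has_real_derivative Re l') (at t0)"
    using bounded_linear.has_vector_derivative[OF bounded_linear_Re assms(2)]
    by (simp add: has_real_derivative_iff_has_vector_derivative)
  have l0: "Re (l t0) = 0" using assms by (simp add: root_branch_def)
  \<comment> \<open>\<open>left\<close> and \<open>right\<close> convert the "all small h" form of
    the monotonicity lemmas into one-sided filters.\<close>
  have left: "\<forall>\<^sub>F t in at_left t0. Q t" if "d > 0" "\<And>h. 0 < h \<Longrightarrow> h < d \<Longrightarrow> Q (t0 - h)" for d Q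
    unfolding eventually_at_left_field
    by (rule exI[of _ "t0 - d"]) (use that(1) that(2)[of "t0 - t" for t] in auto)
  have right: "\<forall>\<^sub>F t in at_right t0. Q t" if "d > 0" "\<And>h. 0 < h \<Longrightarrow> h < d \<Longrightarrow> Q (t0 + h)" for d Q
    unfolding eventually_at_right_field
    by (rule exI[of _ "t0 + d"]) (use that(1) that(2)[of "t - t0" for t] in auto)
  show "crosses_left_to_right P z0 t0" if "Re l' > 0"
    using DERIV_pos_inc_left[OF R that] DERIV_pos_inc_right[OF R that] assms
    unfolding crosses_left_to_right_def l0 by (metis left right)
  show "crosses_right_to_left P z0 t0" if "Re l' < 0"
    using DERIV_neg_dec_left[OF R that] DERIV_neg_dec_right[OF R that] assms
    unfolding crosses_right_to_left_def l0 by (metis left right)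
qed

text \<open>For a negative discriminant \<open>csqrt\<close> is a nonzero imaginary number, so
  \<open>omega_sq\<close> with nonzero \<open>s\<close> could not be real. Otherwise
  \<open>csqrt\<close> agrees with the real root and the defining formula can be solved for
  \<open>2 * x + b\<close>.\<close>

lemma
  assumes "complex_of_real x = omega_sq s b c" "s \<noteq> 0"
  shows omega_sq_real_imp_discriminant_nonneg: "b\<^sup>2 - 4 * c \<ge> 0"
    and omega_sq_real: "2 * x + b = s * sqrt (b\<^sup>2 - 4 * c)"
proof -
  show d: "b\<^sup>2 - 4 * c \<ge> 0"
  proof (rule ccontr)
    assume "\<not> ?thesis"
    then have "csqrt (of_real (b\<^sup>2 - 4 * c)) = \<i> * of_real (sqrt (- (b\<^sup>2 - 4 * c)))"
      by (subst csqrt_of_real_nonpos) auto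
    with \<open>\<not> ?thesis\<close> assms show False
      by (auto simp: omega_sq_def complex_eq_iff)
  qed
  then have "complex_of_real x = of_real (- b / 2 + s * sqrt (b\<^sup>2 - 4 * c) / 2)"
    using assms(1) by (simp add: omega_sq_def flip: of_real_sqrt)
  then show "2 * x + b = s * sqrt (b\<^sup>2 - 4 * c)"
    unfolding of_real_eq_iff by simp
qed

text \<open>\<open>s\<close> selects between the two frequencies. If the discriminant is zero, these
  coincide and the speed is zero, so strict signs and crossings are claimed only for a nonzero
  discriminant.\<close>

theorem mainTheorem2:
  fixes N :: nat and \<mu> K \<kappa> b c s \<omega> \<tau>s :: real
    and P :: "complex \<Rightarrow> real \<Rightarrow> complex"
  assumes "N \<ge> 2" and "\<mu> > 0" and "K \<ge> 1"
    and "\<kappa> \<in> {sqrt (1 - 1 / K\<^sup>2), - sqrt (1 - 1 / K\<^sup>2)}"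
    and "b = b_coeff K \<mu> \<kappa>"
    and "(P = P_Fix K \<mu> \<kappa> \<and> c = c_Fix K \<mu> \<kappa>) \<or> (P = P_U N K \<mu> \<kappa> \<and> c = c_U N K \<mu> \<kappa>)"
    and "s \<in> {1, -1}"
    and "\<omega> > 0" and "complex_of_real (\<omega>\<^sup>2) = omega_sq s b c"
    and "\<tau>s \<ge> 0" and "P (\<i> * of_real \<omega>) \<tau>s = 0"
  shows "b\<^sup>2 - 4 * c \<ge> 0 \<and>
    (\<exists>l l'. root_branch P (\<i> * of_real \<omega>) \<tau>s l \<and> (l has_vector_derivative l') (at \<tau>s) \<and>
       crossing_speed P \<omega> \<tau>s = Re l') \<and>
    (let A = coeff_A \<mu> \<omega>; B = coeff_B K \<mu> \<kappa> \<omega>; C = coeff_C K \<mu> \<kappa> \<omega> \<tau>s; D = coeff_D \<mu> \<omega> \<tau>s in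
       crossing_speed P \<omega> \<tau>s = (A * C + B * D) / (C\<^sup>2 + D\<^sup>2) \<and>
       sgn (crossing_speed P \<omega> \<tau>s) = sgn (A * C + B * D) \<and>
       A * C + B * D = \<omega>\<^sup>2 * (2 * \<omega>\<^sup>2 + b) \<and>
       \<omega>\<^sup>2 * (2 * \<omega>\<^sup>2 + b) = s * \<omega>\<^sup>2 * sqrt (b\<^sup>2 - 4 * c)) \<and>
    (b\<^sup>2 - 4 * c \<noteq> 0 \<longrightarrow>
       (s = 1 \<longrightarrow> sgn (crossing_speed P \<omega> \<tau>s) = 1 \<and>
          crosses_left_to_right P (\<i> * of_real \<omega>) \<tau>s) \<and>
       (s = -1 \<longrightarrow> sgn (crossing_speed P \<omega> \<tau>s) = -1 \<and>
          crosses_right_to_left P (\<i> * of_real \<omega>) \<tau>s))"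
proof -
  define \<alpha> where "\<alpha> = K * \<mu> * (1 - \<kappa>)"
  \<comment> \<open>The two cases merge here; from now on \<open>c\<close> enters only through
    \<open>omega_sq\<close>.\<close>
  obtain \<beta> where P: "P = delayed_quadratic \<mu> \<alpha> \<beta>"
    using assms(6) unfolding P_Fix_eq_delayed_quadratic P_U_eq_delayed_quadratic \<alpha>_def by blast
  define A B C D where "A = coeff_A \<mu> \<omega>" and "B = coeff_B K \<mu> \<kappa> \<omega>"
    and "C = coeff_C K \<mu> \<kappa> \<omega> \<tau>s" and "D = coeff_D \<mu> \<omega> \<tau>s"
  have ABCD: "A = \<mu> * \<omega>\<^sup>2" "B = \<omega>^3 - \<alpha> * \<omega>" "C = \<mu> - \<tau>s * \<omega>\<^sup>2 + \<tau>s * \<alpha>" "D = \<omega> * (2 + \<mu> * \<tau>s)"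
    by (simp_all add: A_def B_def C_def D_def \<alpha>_def coeff_A_def coeff_B_def coeff_C_def coeff_D_def
        algebra_simps)
  \<comment> \<open>Nonnegativity of the delay keeps \<open>D\<close>, the imaginary part of the
    derivative in z, away from zero.\<close>
  have "2 + \<mu> * \<tau>s > 0" using assms by (intro add_pos_nonneg) auto
  then have D: "D \<noteq> 0" using assms by (simp add: ABCD)
  then have CD: "C\<^sup>2 + D\<^sup>2 > 0" by (simp add: add_nonneg_pos)
  have root: "delayed_quadratic \<mu> \<alpha> \<beta> (\<i> * of_real \<omega>) \<tau>s = 0" using assms(11) P by simp
  obtain l where l: "root_branch P (\<i> * of_real \<omega>) \<tau>s l"
      "(l has_vector_derivative Complex A B / Complex C D) (at \<tau>s)"
    using root_branch_delayed_quadratic[OF root] D unfolding P ABCD by blast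
  have speed: "crossing_speed P \<omega> \<tau>s = Re (Complex A B / Complex C D)"
    using crossing_speed_delayed_quadratic[OF root] by (simp add: P ABCD)
  then have quot: "crossing_speed P \<omega> \<tau>s = (A * C + B * D) / (C\<^sup>2 + D\<^sup>2)"
    by (simp add: Re_divide)
  then have sgn: "sgn (crossing_speed P \<omega> \<tau>s) = sgn (A * C + B * D)"
    using CD by (simp add: sgn_divide)
  \<comment> \<open>The delay contributes -mu tau omega^2 (omega^2 - alpha) to \<open>A * C\<close>
    and the opposite amount to \<open>B * D\<close>. What remains is omega^2 (mu^2 + 2 (omega^2 -
    alpha)), and b = mu^2 - 2 alpha.\<close>
  have num: "A * C + B * D = \<omega>\<^sup>2 * (2 * \<omega>\<^sup>2 + b)"
    unfolding ABCD assms(5) b_coeff_def \<alpha>_def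
    by (simp add: power2_eq_square power3_eq_cube algebra_simps)
  have "s \<noteq> 0" using assms(7) by auto
  note disc = omega_sq_real_imp_discriminant_nonneg[OF assms(9) this]
  have val: "\<omega>\<^sup>2 * (2 * \<omega>\<^sup>2 + b) = s * \<omega>\<^sup>2 * sqrt (b\<^sup>2 - 4 * c)"
    unfolding omega_sq_real[OF assms(9) \<open>s \<noteq> 0\<close>] by simp
  \<comment> \<open>With omega and the root of the discriminant both positive, only the factor
    \<open>s\<close> carries a sign.\<close>
  have sgn_s: "sgn (crossing_speed P \<omega> \<tau>s) = s" if "b\<^sup>2 - 4 * c \<noteq> 0"
    using that disc assms(7,8) unfolding sgn num val by (auto simp: sgn_mult)
  have "crosses_left_to_right P (\<i> * of_real \<omega>) \<tau>s" if "b\<^sup>2 - 4 * c \<noteq> 0" "s = 1"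
    using sgn_s that crosses_left_to_rightI[OF l] by (simp add: speed sgn_1_pos)
  moreover have "crosses_right_to_left P (\<i> * of_real \<omega>) \<tau>s" if "b\<^sup>2 - 4 * c \<noteq> 0" "s = -1"
    using sgn_s that crosses_right_to_leftI[OF l] by (simp add: speed sgn_1_neg)
  ultimately show ?thesis
    unfolding Let_def A_def[symmetric] B_def[symmetric] C_def[symmetric] D_def[symmetric]
    using disc l speed quot sgn num val sgn_s by blast
qed

end
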